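(* For any instance of the submodular cover problem with maximum matroid rank constraints, the rank-ratio-greedy algorithm (described in the context) computes an $O(\gamma\cdot\ln k)$-approximation solution in polynomial time, where $k$ is the number of agents and $$\gamma=\min_{H'\in\mathcal{H}^*}\left\{\frac{\sum_{e\in H'}c(e)}{c(H')}\right\},$$ with $\mathcal{H}^*$ the set of all optimal solutions, i.e., of all feasible sets of minimum cost.
   Context: An instance of the submodular cover problem with maximum matroid rank constraints consists of an element set $E$, a set $K=\{1,\dots,k\}$ of $k$ agents, a matroid $(E,\mathcal{I}_i)$ on $E$ for every agent $i\in K$ with rank function $\mathsf{rank}_i(S)=\max\{|T|:T\subseteq S,\ T\in\mathcal{I}_i\}$, and a submodular cost function $c:2^E\to\mathbb{R}_{\ge0}$; write $c(e)=c(\{e\})$. For each agent an oracle that answers a rank query in polynomial time is given. A set $S\subseteq E$ is feasible if $\mathsf{rank}_i(S)=\mathsf{rank}_i(E)$ for all $i\in K$. The goal is to find a feasible $S$ of minimum cost $c(S)$. An $\alpha$-approximation solution is a feasible set $H$ with $c(H)\le\alpha\cdot c(H^* )$, where $H^*$ is a feasible set of minimum cost. Rank-ratio-greedy algorithm: start with $H=\emptyset$; while $\sum_{i=1}^k\mathsf{rank}_i(H)<\sum_{i=1}^k\mathsf{rank}_i(E)$, choose $e^*\in\arg\max_{e\in E\setminus H}\frac{1}{c(e)}\left(\sum_{i=1}^k\mathsf{rank}_i(H\cup\{e\})-\sum_{i=1}^k\mathsf{rank}_i(H)\right)$ and replace $H$ by $H\cup\{e^*\}$; return $H$.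
   Formalization: The ratio is claimed only for k ≥ 2 (ln 1 = 0), for γ finite (0/0 read as 0, undefined if positive over 0), and, when the empty set is feasible, only if c(∅) = 0, since otherwise greedy returns ∅ at arbitrarily large cost. *)

theory Defs
  imports
    "HOL-Library.Extended_Real"
    "HOL-Computational_Algebra.Polynomial"
begin

section \<open>Submodular cover with maximum matroid rank constraints\<close>

definition matroid :: "'a set \<Rightarrow> 'a set set \<Rightarrow> bool" where
  "matroid E \<I> \<longleftrightarrow>
     finite E \<and> \<I> \<subseteq> Pow E \<and> {} \<in> \<I> \<and>
     (\<forall>A B. A \<in> \<I> \<longrightarrow> B \<subseteq> A \<longrightarrow> B \<in> \<I>) \<and>
     (\<forall>A\<in>\<I>. \<forall>B\<in>\<I>. card A < card B \<longrightarrow> (\<exists>x\<in>B - A. insert x A \<in> \<I>))"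

definition mrank :: "'a set set \<Rightarrow> 'a set \<Rightarrow> nat" where
  "mrank \<I> S = Max {card T | T. T \<subseteq> S \<and> T \<in> \<I>}"

definition submodular_on :: "'a set \<Rightarrow> ('a set \<Rightarrow> real) \<Rightarrow> bool" where
  "submodular_on E c \<longleftrightarrow>
     (\<forall>S T. S \<subseteq> E \<longrightarrow> T \<subseteq> E \<longrightarrow> c (S \<union> T) + c (S \<inter> T) \<le> c S + c T)"

text \<open>The agents are \<open>1, \<dots>, k\<close>; agent \<open>i\<close> has the matroid \<open>(E, \<I> i)\<close>. The cost function is
  neither assumed to be monotone nor to vanish on the empty set.\<close>

definition cover_instance ::
    "'a set \<Rightarrow> nat \<Rightarrow> (nat \<Rightarrow> 'a set set) \<Rightarrow> ('a set \<Rightarrow> real) \<Rightarrow> bool" where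
  "cover_instance E k \<I> c \<longleftrightarrow>
     finite E \<and> (\<forall>i\<in>{1..k}. matroid E (\<I> i)) \<and>
     (\<forall>S. S \<subseteq> E \<longrightarrow> 0 \<le> c S) \<and> submodular_on E c"

definition feasible :: "'a set \<Rightarrow> nat \<Rightarrow> (nat \<Rightarrow> 'a set set) \<Rightarrow> 'a set \<Rightarrow> bool" where
  "feasible E k \<I> S \<longleftrightarrow> S \<subseteq> E \<and> (\<forall>i\<in>{1..k}. mrank (\<I> i) S = mrank (\<I> i) E)"

definition optimal ::
    "'a set \<Rightarrow> nat \<Rightarrow> (nat \<Rightarrow> 'a set set) \<Rightarrow> ('a set \<Rightarrow> real) \<Rightarrow> 'a set \<Rightarrow> bool" where
  "optimal E k \<I> c S \<longleftrightarrow> is_arg_min c (feasible E k \<I>) S"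

definition approx_solution ::
    "'a set \<Rightarrow> nat \<Rightarrow> (nat \<Rightarrow> 'a set set) \<Rightarrow> ('a set \<Rightarrow> real) \<Rightarrow> real \<Rightarrow> 'a set \<Rightarrow> bool" where
  "approx_solution E k \<I> c \<alpha> H \<longleftrightarrow>
     feasible E k \<I> H \<and> (\<forall>S. optimal E k \<I> c S \<longrightarrow> c H \<le> \<alpha> * c S)"

text \<open>Extended reals, because optimal solutions may have cost \<open>0\<close>: there \<open>x / 0 = \<infinity>\<close> for
  \<open>x > 0\<close>, and \<open>0 / 0 = 0\<close>. The value is finite whenever the optimal cost is positive.\<close>

definition gamma_ratio ::
    "'a set \<Rightarrow> nat \<Rightarrow> (nat \<Rightarrow> 'a set set) \<Rightarrow> ('a set \<Rightarrow> real) \<Rightarrow> ereal" where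
  "gamma_ratio E k \<I> c =
     Min ((\<lambda>S. ereal (\<Sum>e\<in>S. c {e}) / ereal (c S)) ` {S. optimal E k \<I> c S})"


section \<open>The rank-ratio-greedy algorithm\<close>

definition total_rank :: "nat \<Rightarrow> (nat \<Rightarrow> 'a set set) \<Rightarrow> 'a set \<Rightarrow> nat" where
  "total_rank k \<I> S = (\<Sum>i=1..k. mrank (\<I> i) S)"

text \<open>An element of cost \<open>0\<close> has ratio \<open>\<infinity>\<close> if it increases the total rank, and otherwise
  ratio \<open>0\<close>, since \<open>1 / 0 = \<infinity>\<close> and \<open>\<infinity> * 0 = 0\<close> in the extended reals.\<close>

definition rank_ratio ::
    "nat \<Rightarrow> (nat \<Rightarrow> 'a set set) \<Rightarrow> ('a set \<Rightarrow> real) \<Rightarrow> 'a set \<Rightarrow> 'a \<Rightarrow> ereal" where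
  "rank_ratio k \<I> c H e =
     1 / ereal (c {e}) * ereal (real (total_rank k \<I> (H \<union> {e})) - real (total_rank k \<I> H))"

text \<open>A relation rather than a function: ties are broken arbitrarily.\<close>

inductive greedy_step ::
    "'a set \<Rightarrow> nat \<Rightarrow> (nat \<Rightarrow> 'a set set) \<Rightarrow> ('a set \<Rightarrow> real) \<Rightarrow> 'a set \<Rightarrow> 'a set \<Rightarrow> bool"
  for E k \<I> c where
  "total_rank k \<I> H < total_rank k \<I> E \<Longrightarrow>
   is_arg_max (rank_ratio k \<I> c H) (\<lambda>e. e \<in> E - H) e \<Longrightarrow>
   greedy_step E k \<I> c H (H \<union> {e})"

definition greedy_output ::
    "'a set \<Rightarrow> nat \<Rightarrow> (nat \<Rightarrow> 'a set set) \<Rightarrow> ('a set \<Rightarrow> real) \<Rightarrow> 'a set \<Rightarrow> bool" where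
  "greedy_output E k \<I> c H \<longleftrightarrow>
     (greedy_step E k \<I> c)\<^sup>*\<^sup>* {} H \<and> \<not> total_rank k \<I> H < total_rank k \<I> E"


section \<open>Programs with a rank oracle\<close>

text \<open>Programs work on finitely many variables of three kinds, each kind numbered by naturals:
  counters, real registers, and bit arrays (seen as sets of indices). Counters and real registers
  have no multiplication, so that values computed in \<open>t\<close> steps exceed the input values at most by
  a factor exponential in \<open>t\<close>, and counting every instruction as one step is polynomially related
  to bit complexity.\<close>

datatype test =
    Less nat nat
  | RLess nat nat
  | Member nat nat

datatype com =
    Skip
  | Const nat nat
  | Add nat nat nat
  | Sub nat nat nat
  | RZero nat
  | RAdd nat nat nat
  | Insert nat nat
  | Remove nat nat
  | LoadCost nat nat
  | RankQuery nat nat nat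
  | Seq com com
  | Cond test com com
  | While test com

record config =
  cnt :: "nat \<Rightarrow> nat"
  reg :: "nat \<Rightarrow> real"
  arr :: "nat \<Rightarrow> nat set"

fun holds :: "test \<Rightarrow> config \<Rightarrow> bool" where
  "holds (Less x y) s \<longleftrightarrow> cnt s x < cnt s y"
| "holds (RLess r r') s \<longleftrightarrow> reg s r < reg s r'"
| "holds (Member x a) s \<longleftrightarrow> cnt s x \<in> arr s a"

text \<open>\<open>exec w R \<tau> P s t s'\<close>: started in \<open>s\<close>, the program \<open>P\<close> halts in \<open>s'\<close> after time \<open>t\<close>.
  Here \<open>w j\<close> is the cost of the \<open>j\<close>-th element, and the oracle of agent \<open>i\<close> answers the query \<open>A\<close>
  with \<open>R i A\<close> in time \<open>\<tau> i A\<close>.\<close>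

inductive exec ::
    "(nat \<Rightarrow> real) \<Rightarrow> (nat \<Rightarrow> nat set \<Rightarrow> nat) \<Rightarrow> (nat \<Rightarrow> nat set \<Rightarrow> nat) \<Rightarrow>
     com \<Rightarrow> config \<Rightarrow> nat \<Rightarrow> config \<Rightarrow> bool"
  for w R \<tau> where
  Skip: "exec w R \<tau> Skip s 1 s"
| Const: "exec w R \<tau> (Const x n) s 1 (s\<lparr>cnt := (cnt s)(x := n)\<rparr>)"
| Add: "exec w R \<tau> (Add x y z) s 1 (s\<lparr>cnt := (cnt s)(x := cnt s y + cnt s z)\<rparr>)"
| Sub: "exec w R \<tau> (Sub x y z) s 1 (s\<lparr>cnt := (cnt s)(x := cnt s y - cnt s z)\<rparr>)"
| RZero: "exec w R \<tau> (RZero r) s 1 (s\<lparr>reg := (reg s)(r := 0)\<rparr>)"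
| RAdd: "exec w R \<tau> (RAdd r r1 r2) s 1 (s\<lparr>reg := (reg s)(r := reg s r1 + reg s r2)\<rparr>)"
| Insert: "exec w R \<tau> (Insert x a) s 1 (s\<lparr>arr := (arr s)(a := arr s a \<union> {cnt s x})\<rparr>)"
| Remove: "exec w R \<tau> (Remove x a) s 1 (s\<lparr>arr := (arr s)(a := arr s a - {cnt s x})\<rparr>)"
| LoadCost: "exec w R \<tau> (LoadCost r x) s 1 (s\<lparr>reg := (reg s)(r := w (cnt s x))\<rparr>)"
| RankQuery: "exec w R \<tau> (RankQuery x y a) s (1 + \<tau> (cnt s y) (arr s a))
    (s\<lparr>cnt := (cnt s)(x := R (cnt s y) (arr s a))\<rparr>)"
| Seq: "exec w R \<tau> P s t s' \<Longrightarrow> exec w R \<tau> Q s' t' s'' \<Longrightarrow> exec w R \<tau> (Seq P Q) s (t + t') s''"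
| CondT: "holds b s \<Longrightarrow> exec w R \<tau> P s t s' \<Longrightarrow> exec w R \<tau> (Cond b P Q) s (1 + t) s'"
| CondF: "\<not> holds b s \<Longrightarrow> exec w R \<tau> Q s t s' \<Longrightarrow> exec w R \<tau> (Cond b P Q) s (1 + t) s'"
| WhileF: "\<not> holds b s \<Longrightarrow> exec w R \<tau> (While b P) s 1 s"
| WhileT: "holds b s \<Longrightarrow> exec w R \<tau> P s t s' \<Longrightarrow> exec w R \<tau> (While b P) s' t' s'' \<Longrightarrow>
    exec w R \<tau> (While b P) s (1 + t + t') s''"

definition initial :: "nat \<Rightarrow> nat \<Rightarrow> config" where
  "initial n k = \<lparr>cnt = (\<lambda>_. 0)(0 := n, 1 := k), reg = (\<lambda>_. 0), arr = (\<lambda>_. {})\<rparr>"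

text \<open>The program sees the elements of \<open>E\<close> only through their positions in an enumeration \<open>es\<close>;
  the result is read off array \<open>0\<close>.\<close>

definition computes_within ::
    "com \<Rightarrow> 'a list \<Rightarrow> nat \<Rightarrow> (nat \<Rightarrow> 'a set set) \<Rightarrow> ('a set \<Rightarrow> real) \<Rightarrow>
     (nat \<Rightarrow> nat set \<Rightarrow> nat) \<Rightarrow> nat \<Rightarrow> 'a set \<Rightarrow> bool" where
  "computes_within P es k \<I> c \<tau> T H \<longleftrightarrow>
     (\<exists>t s. exec (\<lambda>j. c {es ! j}) (\<lambda>i A. mrank (\<I> i) ((!) es ` A)) \<tau> P
              (initial (length es) k) t s \<and>
            t \<le> T \<and> arr s 0 \<subseteq> {..<length es} \<and> H = (!) es ` arr s 0)"

end

(*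
  The total rank f is monotone and submodular, and one element raises it by at most k. For an optimal
  set S, follow the price p = c(e)/gain that greedy pays per unit of rank: it never decreases, and
  p * gain(x) is at most c(x) for every x. Charging each x in S the harmonic number of its current
  gain bounds the total price by harm k times the sum of c(x) over S (Wolsey), while submodularity
  and nonnegativity of c bound c(H) by the sum of its singleton costs. Since harm k is at most
  1 + ln k, which is at most (1 + 1/ln 2) ln k for k at least 2, this gives the ratio.
  For the running time, greedy compares ratios by cross-multiplication, and the products, having a
  factor at most k, are computed by repeated addition.
*)

theory Submission
  imports Defs "HOL-Analysis.Harmonic_Numbers"
begin

section \<open>Matroid rank\<close>

text \<open>Charging works for additive weights, so the argument runs on the singleton costs
  \<open>c {e}\<close>. The submodular \<open>c\<close> enters only at the ends: its value at the
  output is bounded by singleton costs, and the sum over the optimal set attaining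
  \<open>gamma_ratio\<close> is turned back into gamma times its cost. The side conditions exclude
  genuine failures: \<open>ln k\<close> vanishes at \<open>k = 1\<close>; a feasible empty set is
  what greedy returns, yet \<open>c {}\<close> may be positive with no singleton to charge it to;
  and \<open>real_of_ereal\<close> sends an infinite gamma to 0. Elements of cost 0 are the
  recurring obstacle: the cross-multiplied order is not transitive once gain and cost are both 0, so
  a positive gain has to accompany it. \<open>submodular_cover\<close> is instantiated twice, on
  elements and on their positions in an enumeration. The bound covers every way of breaking ties;
  the program realizes one of them.\<close>

lemma mrank_ge_card:
  assumes "matroid E \<I>" "T \<subseteq> S" "T \<in> \<I>"
  shows "card T \<le> mrank \<I> S"
proof -
  have "finite \<I>"
    using assms(1) unfolding matroid_def by (meson finite_Pow_iff finite_subset)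
  hence "finite {card T | T. T \<subseteq> S \<and> T \<in> \<I>}"
    by simp
  thus ?thesis
    unfolding mrank_def using assms(2,3) by (intro Max_ge) auto
qed

lemma mrank_attained:
  assumes "matroid E \<I>"
  obtains T where "T \<subseteq> S" "T \<in> \<I>" "card T = mrank \<I> S"
proof -
  have "finite \<I>" "{} \<in> \<I>"
    using assms unfolding matroid_def by (meson finite_Pow_iff finite_subset)+
  hence "mrank \<I> S \<in> {card T | T. T \<subseteq> S \<and> T \<in> \<I>}"
    unfolding mrank_def by (intro Max_in) auto
  thus thesis
    using that by auto
qed

lemma mrank_mono:
  assumes "matroid E \<I>" "A \<subseteq> B"
  shows "mrank \<I> A \<le> mrank \<I> B"
  using mrank_attained[OF assms(1), of A] mrank_ge_card[OF assms(1)] assms(2)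
  by (metis order_trans)

lemma mrank_insert_le:
  assumes "matroid E \<I>"
  shows "mrank \<I> (insert e S) \<le> Suc (mrank \<I> S)"
proof -
  obtain U where U: "U \<subseteq> insert e S" "U \<in> \<I>" "card U = mrank \<I> (insert e S)"
    using mrank_attained[OF assms] .
  have "U - {e} \<in> \<I>"
    using assms U(2) unfolding matroid_def by blast
  hence "card (U - {e}) \<le> mrank \<I> S"
    using U(1) by (intro mrank_ge_card[OF assms]) auto
  moreover have "card U \<le> Suc (card (U - {e}))"
    by (metis card_Diff1_le card_Suc_Diff1 card.infinite finite_Diff2 Diff_empty Diff_insert0
        finite.emptyI finite_insert le_SucI le_refl zero_le)
  ultimately show ?thesis
    using U(3) by simp
qed

text \<open>Exchange against a maximum independent subset of \<open>S\<close> enlarges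
  \<open>T\<close> inside \<open>S\<close>; the induction is on the number of missing
  elements.\<close>

lemma independent_extends_to_basis:
  assumes M: "matroid E \<I>" and T: "T \<subseteq> S" "T \<in> \<I>"
  obtains U where "T \<subseteq> U" "U \<subseteq> S" "U \<in> \<I>" "card U = mrank \<I> S"
proof -
  have "\<exists>U. T \<subseteq> U \<and> U \<subseteq> S \<and> U \<in> \<I> \<and> card U = mrank \<I> S"
    using T
  proof (induction "mrank \<I> S - card T" arbitrary: T)
    case 0
    thus ?case
      using mrank_ge_card[OF M] by (metis diff_is_0_eq order_antisym order_refl)
  next
    case (Suc d)
    obtain V where V: "V \<subseteq> S" "V \<in> \<I>" "card V = mrank \<I> S"
      using mrank_attained[OF M] .
    have "card T < card V"
      using Suc.hyps(2) V(3) by simp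
    then obtain x where x: "x \<in> V - T" "insert x T \<in> \<I>"
      using M V(2) Suc.prems(2) unfolding matroid_def by blast
    have "finite T"
      using M Suc.prems(2) unfolding matroid_def by (meson PowD finite_subset subsetD)
    hence "card (insert x T) = Suc (card T)"
      using x(1) by simp
    hence "\<exists>U. insert x T \<subseteq> U \<and> U \<subseteq> S \<and> U \<in> \<I> \<and> card U = mrank \<I> S"
      using Suc.hyps(2) x Suc.prems V(1) by (intro Suc.hyps(1)) auto
    thus ?case
      by blast
  qed
  thus thesis
    using that by blast
qed

text \<open>If \<open>e\<close> raises the rank of \<open>B\<close>, grow a maximum independent set
  \<open>T\<close> of \<open>A\<close> to one \<open>U\<close> of \<open>B\<close>. Exchange with a
  larger set inside \<open>insert e B\<close> can add only \<open>e\<close> to \<open>U\<close>, as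
  \<open>U\<close> is maximum in \<open>B\<close>; so \<open>insert e T\<close> is independent and
  \<open>e\<close> raises the rank of \<open>A\<close> too.\<close>

lemma mrank_diminishing:
  assumes M: "matroid E \<I>" and AB: "A \<subseteq> B"
  shows "mrank \<I> (insert e B) + mrank \<I> A \<le> mrank \<I> (insert e A) + mrank \<I> B"
proof (cases "mrank \<I> (insert e B) = mrank \<I> B")
  case True
  thus ?thesis
    using mrank_mono[OF M subset_insertI[of A e]] by linarith
next
  case False
  hence gt: "mrank \<I> B < mrank \<I> (insert e B)"
    using mrank_mono[OF M subset_insertI[of B e]] by linarith
  obtain T where T: "T \<subseteq> A" "T \<in> \<I>" "card T = mrank \<I> A"
    using mrank_attained[OF M] .
  obtain U where U: "T \<subseteq> U" "U \<subseteq> B" "U \<in> \<I>" "card U = mrank \<I> B"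
    using independent_extends_to_basis[OF M, of T B] T AB by blast
  obtain V where V: "V \<subseteq> insert e B" "V \<in> \<I>" "card V = mrank \<I> (insert e B)"
    using mrank_attained[OF M] .
  have "card U < card V"
    using gt U(4) V(3) by simp
  then obtain x where x: "x \<in> V - U" "insert x U \<in> \<I>"
    using M U(3) V(2) unfolding matroid_def by blast
  have fin: "finite J" if "J \<in> \<I>" for J
    using M that unfolding matroid_def by (meson PowD finite_subset subsetD)
  have "x \<notin> B"
  proof
    assume "x \<in> B"
    hence "card (insert x U) \<le> mrank \<I> B"
      using mrank_ge_card[OF M _ x(2), of B] U(2) by simp
    thus False
      using x(1) U(3,4) fin by simp
  qed
  hence xe: "x = e"
    using x(1) V(1) by blast
  have "insert e T \<in> \<I>"
    using M x(2) U(1) unfolding xe matroid_def by (meson insert_mono)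
  hence "card (insert e T) \<le> mrank \<I> (insert e A)"
    using T(1) by (intro mrank_ge_card[OF M]) auto
  moreover have "e \<notin> T"
    using x(1) U(1) xe by blast
  ultimately have "Suc (mrank \<I> A) \<le> mrank \<I> (insert e A)"
    using T(2,3) fin by simp
  thus ?thesis
    using mrank_insert_le[OF M, of e B] by simp
qed

section \<open>Greedy submodular cover\<close>

text \<open>\<open>harm n - harm m\<close> consists of \<open>n - m\<close> terms, each at least
  \<open>1 / n\<close>.\<close>

lemma harm_diff_ge:
  assumes "m \<le> (n::nat)"
  shows "real (n - m) / real n \<le> (harm n - harm m :: real)"
  using assms
proof (induction n rule: dec_induct)
  case (step n)
  have "real (Suc n - m) / real (Suc n) = real (n - m) / real (Suc n) + 1 / real (Suc n)"
    using step.hyps by (simp add: Suc_diff_le add_divide_distrib)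
  also have "\<dots> \<le> real (n - m) / real n + 1 / real (Suc n)"
    using step.hyps by (cases "n = 0") (auto intro!: divide_left_mono)
  also have "\<dots> \<le> harm (Suc n) - harm m"
    using step.IH by (simp add: harm_Suc inverse_eq_divide)
  finally show ?case .
qed simp

text \<open>\<open>f\<close> is constrained on all sets, not only on subsets of \<open>E\<close>:
  \<open>mrank\<close> behaves well there too, which saves carrying membership conditions.\<close>

locale submodular_cover =
  fixes E :: "'a set" and f :: "'a set \<Rightarrow> nat" and w :: "'a \<Rightarrow> real"
  assumes finite_E: "finite E"
    and f_mono: "A \<subseteq> B \<Longrightarrow> f A \<le> f B"
    and f_diminishing: "A \<subseteq> B \<Longrightarrow> f (insert e B) + f A \<le> f (insert e A) + f B"
    and w_nonneg: "e \<in> E \<Longrightarrow> 0 \<le> w e"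
begin

definition gain :: "'a set \<Rightarrow> 'a \<Rightarrow> nat" where
  "gain H e = f (insert e H) - f H"

text \<open>Maximality of \<open>gain H e / w e\<close>, cross-multiplied so that elements of cost \<open>0\<close> need no
  special treatment.\<close>

definition best :: "'a set \<Rightarrow> 'a \<Rightarrow> bool" where
  "best H e \<longleftrightarrow> e \<in> E - H \<and> 0 < gain H e \<and>
     (\<forall>e'\<in>E - H. real (gain H e') * w e \<le> real (gain H e) * w e')"

lemma f_insert: "f (insert e H) = f H + gain H e"
  using f_mono[OF subset_insertI[of H e]] by (simp add: gain_def)

lemma gain_antimono: "A \<subseteq> B \<Longrightarrow> gain B e \<le> gain A e"
  using f_diminishing[of A B e] by (simp add: f_insert)

lemma f_Un_le_sum_gain:
  assumes "finite S"
  shows "f (H \<union> S) \<le> f H + (\<Sum>e\<in>S. gain H e)"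
  using assms
proof induction
  case (insert x S)
  have "f (H \<union> insert x S) = f (H \<union> S) + gain (H \<union> S) x"
    by (simp add: f_insert)
  also have "\<dots> \<le> f (H \<union> S) + gain H x"
    using gain_antimono[of H "H \<union> S" x] by simp
  finally show ?case
    using insert by simp
qed simp

text \<open>Diminishing gains make incompleteness visible to single elements. This yields a local
  stopping test, and a positive gain for greedy to choose.\<close>

lemma complete_iff_gain_eq_0:
  assumes "H \<subseteq> E"
  shows "f H < f E \<longleftrightarrow> (\<exists>e\<in>E - H. 0 < gain H e)"
proof
  assume "f H < f E"
  moreover have "f E \<le> f H + (\<Sum>e\<in>E - H. gain H e)"
    using f_Un_le_sum_gain[of "E - H" H] finite_E assms by (simp add: Un_absorb1)
  ultimately have "(\<Sum>e\<in>E - H. gain H e) \<noteq> 0"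
    by linarith
  thus "\<exists>e\<in>E - H. 0 < gain H e"
    using sum.neutral[of "E - H" "gain H"] by (metis gr0I)
next
  assume "\<exists>e\<in>E - H. 0 < gain H e"
  then obtain e where "e \<in> E - H" "0 < gain H e"
    by blast
  moreover from this have "f (insert e H) \<le> f E"
    using assms by (intro f_mono) auto
  ultimately show "f H < f E"
    by (simp add: f_insert)
qed

text \<open>The price \<open>\<theta>\<close> paid per unit of rank is nondecreasing along the run, and the bound holds for every
  \<open>\<theta>\<close> that is at most the current price. The claim for \<open>\<theta> = 0\<close> alone is not inductive, because a
  greedy step may lower the sum of the gains over \<open>S\<close> by less than the rank it gains.\<close>

lemma greedy_run_cost:
  assumes run: "(\<lambda>A B. \<exists>e. best A e \<and> B = insert e A)\<^sup>*\<^sup>* H G"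
    and G: "f G = f E" "H \<subseteq> E"
    and S: "S \<subseteq> E" "f S = f E"
    and \<theta>: "0 \<le> (\<theta> :: real)" "\<And>e. e \<in> E \<Longrightarrow> \<theta> * gain H e \<le> w e"
  shows "H \<subseteq> G \<and> G \<subseteq> E \<and> sum w (G - H) \<le>
    \<theta> * (real (f E) - real (f H)) + (\<Sum>e\<in>S. w e * harm (gain H e) - \<theta> * gain H e)"
  using run G(2) \<theta>
proof (induction arbitrary: \<theta> rule: converse_rtranclp_induct)
  case base
  have "gain G e = 0" if "e \<in> E" for e
    using f_mono[of "insert e G" E] base that G(1) by (auto simp: gain_def)
  hence "(\<Sum>e\<in>S. w e * harm (gain G e) - \<theta> * gain G e) = 0"
    using S by (intro sum.neutral) (auto simp: harm_def)
  thus ?case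
    using base G(1) by simp
next
  case (step H H')
  then obtain e where e: "best H e" and H': "H' = insert e H"
    by blast
  have eE: "e \<in> E" "e \<notin> H" and g: "0 < gain H e"
    and opt: "\<And>e'. e' \<in> E - H \<Longrightarrow> real (gain H e') * w e \<le> real (gain H e) * w e'"
    using e by (auto simp: best_def)
  define p where "p = w e / gain H e"
  have we: "w e = p * gain H e"
    using g by (simp add: p_def)
  \<comment> \<open>\<open>best\<close> compares only elements outside \<open>H\<close>; an element
    of \<open>H\<close> has gain 0, so its cost need only be nonnegative.\<close>
  have p: "p * gain H x \<le> w x" if "x \<in> E" for x
  proof (cases "x \<in> H")
    case True
    thus ?thesis
      using w_nonneg[OF that] by (simp add: gain_def insert_absorb)
  next
    case False
    thus ?thesis
      using opt[of x] that g by (simp add: p_def field_simps)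
  qed
  have "\<theta> * gain H e \<le> p * gain H e"
    using step.prems(3)[OF eE(1)] we by simp
  hence \<theta>p: "\<theta> \<le> p"
    using g by simp
  have p0: "0 \<le> p"
    using \<theta>p step.prems(2) by simp
  have HE: "H' \<subseteq> E" "H \<subseteq> H'"
    using step.prems(1) eE H' by auto
  \<comment> \<open>Gains only shrink, so \<open>p\<close> can serve as the new
    \<open>\<theta>\<close> for \<open>H'\<close>.\<close>
  have p': "p * gain H' x \<le> w x" if "x \<in> E" for x
    using p[OF that] gain_antimono[OF HE(2), of x] p0
    by (meson mult_left_mono of_nat_mono order_trans)
  have IH: "H' \<subseteq> G" "G \<subseteq> E" "sum w (G - H') \<le>
      p * (real (f E) - real (f H')) + (\<Sum>e\<in>S. w e * harm (gain H' e) - p * gain H' e)"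
    using step.IH[OF HE(1) p0 p'] by auto
  \<comment> \<open>When the gain of \<open>x\<close> falls from \<open>a\<close> to
    \<open>b\<close>, the price term frees \<open>p * (a - b)\<close>. Since
    \<open>p * a <= w x\<close>, this is at most \<open>w x * (a - b) / a\<close>, which the drop of
    the harmonic term covers.\<close>
  have potential: "w x * harm (gain H' x) - p * gain H' x \<le> w x * harm (gain H x) - p * gain H x"
    if x: "x \<in> S" for x
  proof (cases "gain H x = 0")
    case True
    thus ?thesis
      using gain_antimono[OF HE(2), of x] by simp
  next
    case False
    let ?a = "gain H x" and ?b = "gain H' x"
    have ba: "?b \<le> ?a"
      by (rule gain_antimono[OF HE(2)])
    have wx: "0 \<le> w x"
      using x S(1) w_nonneg by blast
    have "p * real (?a - ?b) = (p * ?a) * (real (?a - ?b) / ?a)"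
      using False by simp
    also have "\<dots> \<le> w x * (real (?a - ?b) / ?a)"
      using p x S(1) by (intro mult_right_mono) auto
    also have "\<dots> \<le> w x * (harm ?a - harm ?b)"
      by (intro mult_left_mono harm_diff_ge ba wx)
    finally show ?thesis
      using ba by (simp add: of_nat_diff algebra_simps)
  qed
  have pot: "(\<Sum>x\<in>S. w x * harm (gain H' x) - p * gain H' x)
      \<le> (\<Sum>x\<in>S. w x * harm (gain H x) - p * gain H x)"
    by (intro sum_mono potential)
  have "G - H = insert e (G - H')" "e \<notin> G - H'" "finite (G - H')"
    using H' IH(1,2) eE finite_E finite_subset by auto
  hence "sum w (G - H) = p * gain H e + sum w (G - H')"
    using we by simp
  also have "\<dots> \<le> p * gain H e + (p * (real (f E) - real (f H'))
      + (\<Sum>e\<in>S. w e * harm (gain H e) - p * gain H e))"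
    using IH(3) pot by simp
  also have "\<dots> = p * (real (f E) - real (f H)) + (\<Sum>e\<in>S. w e * harm (gain H e) - p * gain H e)"
    by (simp add: H' f_insert algebra_simps)
  also have "\<dots> = p * (real (f E) - real (f H) - (\<Sum>e\<in>S. gain H e))
      + (\<Sum>e\<in>S. w e * harm (gain H e))"
    by (simp add: sum_subtractf sum_distrib_left algebra_simps)
  \<comment> \<open>The coefficient of \<open>p\<close> is nonpositive, because the gains over
    \<open>S\<close> suffice to reach \<open>f E\<close>; lowering the price to
    \<open>\<theta>\<close> can only raise the bound.\<close>
  also have "\<dots> \<le> \<theta> * (real (f E) - real (f H) - (\<Sum>e\<in>S. gain H e))
      + (\<Sum>e\<in>S. w e * harm (gain H e))"
  proof -
    have "f E \<le> f (H \<union> S)"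
      using S(2) f_mono[of S "H \<union> S"] by simp
    also have "\<dots> \<le> f H + (\<Sum>e\<in>S. gain H e)"
      using S(1) finite_E finite_subset by (intro f_Un_le_sum_gain) auto
    finally have "real (f E) - real (f H) - (\<Sum>e\<in>S. gain H e) \<le> 0"
      by (simp flip: of_nat_sum of_nat_add)
    thus ?thesis
      using mult_right_mono_neg[OF \<theta>p] by simp
  qed
  also have "\<dots> = \<theta> * (real (f E) - real (f H)) + (\<Sum>e\<in>S. w e * harm (gain H e) - \<theta> * gain H e)"
    by (simp add: sum_subtractf sum_distrib_left algebra_simps)
  finally show ?case
    using IH(1,2) HE(2) by auto
qed

lemma greedy_cost:
  assumes run: "(\<lambda>A B. \<exists>e. best A e \<and> B = insert e A)\<^sup>*\<^sup>* {} G" and G: "f G = f E"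
    and S: "S \<subseteq> E" "f S = f E"
    and k: "\<And>e. e \<in> E \<Longrightarrow> gain {} e \<le> k"
  shows "sum w G \<le> harm k * sum w S"
proof -
  have "sum w G \<le> (\<Sum>e\<in>S. w e * harm (gain {} e))"
    using greedy_run_cost[OF run G _ S, of 0] w_nonneg by simp
  also have "\<dots> \<le> (\<Sum>e\<in>S. w e * harm k)"
    using S(1) k w_nonneg by (intro sum_mono mult_left_mono harm_mono) auto
  finally show ?thesis
    by (simp add: sum_distrib_left mult.commute)
qed

end

section \<open>The greedy program\<close>

text \<open>Counter usage: \<open>0, 1\<close> hold \<open>n, k\<close>; \<open>2\<close> is the element under examination; \<open>3, 5, 8\<close> belong to the
  inner loops; \<open>4\<close> and \<open>11\<close> hold the constants \<open>1\<close> and \<open>0\<close>; \<open>6\<close> is the total rank of the current set,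
  \<open>7\<close> the gain of the element under examination; \<open>9\<close> and \<open>10\<close> are the gain and the index of the
  best element so far (gain \<open>0\<close> meaning none), whose cost is in register \<open>1\<close>. Ratios are compared by
  cross-multiplication in registers \<open>2\<close> and \<open>3\<close>. Stopping when no element has positive gain spares
  the program the total rank of the ground set.\<close>

definition rank_sum :: "nat \<Rightarrow> com" where
  "rank_sum d = Seq (Const 3 0) (Seq (Const d 0) (While (Less 3 1)
     (Seq (Add 3 3 4) (Seq (RankQuery 5 3 0) (Add d d 5)))))"

definition scale :: "nat \<Rightarrow> nat \<Rightarrow> nat \<Rightarrow> com" where
  "scale r r' x = Seq (RZero r) (Seq (Const 8 0) (While (Less 8 x)
     (Seq (Add 8 8 4) (RAdd r r r'))))"

definition select :: com where
  "select = Seq (Const 9 0) (Seq (Add 9 9 7) (Seq (Const 10 0) (Seq (Add 10 10 2) (LoadCost 1 2))))"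

text \<open>The element joins array 0 only while its rank is queried. Without a candidate it is
  selected even at gain 0, which leaves counter 9 at 0 and so still means none.\<close>

definition examine :: com where
  "examine = Seq (Insert 2 0) (Seq (rank_sum 7) (Seq (Remove 2 0) (Seq (Sub 7 7 6) (Seq (LoadCost 0 2)
     (Cond (Less 11 9)
       (Seq (scale 2 0 9) (Seq (scale 3 1 7) (Cond (RLess 2 3) select Skip)))
       select)))))"

definition scan :: com where
  "scan = Seq (rank_sum 6) (Seq (Const 9 0) (Seq (Const 2 0)
     (While (Less 2 0) (Seq (Cond (Member 2 0) Skip examine) (Add 2 2 4)))))"

text \<open>Counter 9 starts at 1 only to enter the loop; thereafter it is the best gain found by
  the last scan.\<close>

definition greedy_program :: com where
  "greedy_program = Seq (Const 4 1) (Seq (Const 9 1)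
     (While (Less 11 9) (Seq scan (Cond (Less 11 9) (Insert 10 0) Skip))))"

locale rank_machine = submodular_cover "{..<n}" F w for n :: nat and F w +
  fixes R \<tau> :: "nat \<Rightarrow> nat set \<Rightarrow> nat" and k B :: nat
  assumes F_eq: "F A = (\<Sum>i=1..k. R i A)"
    and R_insert_le: "i \<in> {1..k} \<Longrightarrow> R i (insert j A) \<le> Suc (R i A)"
    and query_time: "i \<in> {1..k} \<Longrightarrow> A \<subseteq> {..<n} \<Longrightarrow> \<tau> i A \<le> B"
begin

lemma gain_le: "gain A j \<le> k"
proof -
  have "F (insert j A) \<le> (\<Sum>i=1..k. R i A + 1)"
    unfolding F_eq using R_insert_le by (intro sum_mono) auto
  also have "\<dots> = F A + k"
    by (simp only: sum.distrib F_eq) simp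
  finally show ?thesis
    by (simp add: gain_def)
qed

section \<open>Weakest preconditions with a time budget\<close>

definition runs :: "com \<Rightarrow> config \<Rightarrow> nat \<Rightarrow> (config \<Rightarrow> bool) \<Rightarrow> bool" where
  "runs P s T Q \<longleftrightarrow> (\<exists>t s'. exec w R \<tau> P s t s' \<and> t \<le> T \<and> Q s')"

lemma runs_mono: "runs P s T Q \<Longrightarrow> T \<le> T' \<Longrightarrow> (\<And>s'. Q s' \<Longrightarrow> Q' s') \<Longrightarrow> runs P s T' Q'"
  unfolding runs_def by (meson order_trans)

lemma runs_exec: "exec w R \<tau> P s t s' \<Longrightarrow> t \<le> T \<Longrightarrow> Q s' \<Longrightarrow> runs P s T Q"
  unfolding runs_def by blast

lemmas runs_Skip = runs_exec[OF exec.Skip]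
  and runs_Const = runs_exec[OF exec.Const]
  and runs_Add = runs_exec[OF exec.Add]
  and runs_Sub = runs_exec[OF exec.Sub]
  and runs_RZero = runs_exec[OF exec.RZero]
  and runs_RAdd = runs_exec[OF exec.RAdd]
  and runs_Insert = runs_exec[OF exec.Insert]
  and runs_Remove = runs_exec[OF exec.Remove]
  and runs_LoadCost = runs_exec[OF exec.LoadCost]

lemma runs_RankQuery:
  assumes "cnt s y \<in> {1..k}" "arr s a \<subseteq> {..<n}" "1 + B \<le> T"
    and "Q (s\<lparr>cnt := (cnt s)(x := R (cnt s y) (arr s a))\<rparr>)"
  shows "runs (RankQuery x y a) s T Q"
  using query_time[OF assms(1,2)] assms(3,4) by (intro runs_exec[OF exec.RankQuery]) auto

lemma runs_Seq:
  assumes "runs P s T1 (\<lambda>s'. runs P' s' T2 Q)" "T1 + T2 \<le> T"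
  shows "runs (Seq P P') s T Q"
proof -
  obtain t s' t' s'' where "exec w R \<tau> P s t s'" "t \<le> T1" "exec w R \<tau> P' s' t' s''" "t' \<le> T2" "Q s''"
    using assms(1) unfolding runs_def by blast
  thus ?thesis
    unfolding runs_def using assms(2) by (intro exI[of _ "t + t'"] exI[of _ s'']) (auto intro: exec.Seq)
qed

text \<open>A unit-cost instruction takes 1 off the budget, so straight-line code needs no guessed
  time splits.\<close>

lemma runs_Seq_step:
  assumes "runs P s 1 (\<lambda>s'. runs P' s' (T - 1) Q)" "1 \<le> T"
  shows "runs (Seq P P') s T Q"
  using runs_Seq[OF assms(1)] assms(2) by simp

lemma runs_Cond:
  assumes "holds b s \<Longrightarrow> runs P s (T - 1) Q" "\<not> holds b s \<Longrightarrow> runs P' s (T - 1) Q" "1 \<le> T"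
  shows "runs (Cond b P P') s T Q"
proof -
  have "\<exists>t s'. exec w R \<tau> (Cond b P P') s (1 + t) s' \<and> t \<le> T - 1 \<and> Q s'"
    using assms(1,2) unfolding runs_def by (cases "holds b s") (meson exec.CondT exec.CondF)+
  thus ?thesis
    unfolding runs_def using assms(3) by (metis add.commute le_diff_conv2)
qed

text \<open>The invariant carries its variant \<open>m\<close>. Each of at most \<open>m\<close>
  iterations costs its test and \<open>T\<close>; the leading 1 is the final failed test.\<close>

lemma runs_While:
  assumes "\<And>m s. I m s \<Longrightarrow> holds b s \<Longrightarrow> runs P s T (\<lambda>s'. \<exists>m'<m. I m' s')"
    and "I m s" "1 + m * (T + 1) \<le> T'"
    and "\<And>m s. I m s \<Longrightarrow> \<not> holds b s \<Longrightarrow> Q s"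
  shows "runs (While b P) s T' Q"
proof -
  have "runs (While b P) s (1 + m * (T + 1)) (\<lambda>s. (\<exists>m. I m s) \<and> \<not> holds b s)"
    using assms(2)
  proof (induction m arbitrary: s rule: less_induct)
    case (less m)
    show ?case
    proof (cases "holds b s")
      case False
      thus ?thesis
        using less.prems by (intro runs_exec[OF exec.WhileF]) auto
    next
      case True
      obtain t s' m' where s': "exec w R \<tau> P s t s'" "t \<le> T" "m' < m" "I m' s'"
        using assms(1)[OF less.prems True] unfolding runs_def by blast
      obtain t' s'' where s'': "exec w R \<tau> (While b P) s' t' s''" "t' \<le> 1 + m' * (T + 1)"
          "(\<exists>m. I m s'') \<and> \<not> holds b s''"
        using less.IH[OF s'(3,4)] unfolding runs_def by blast
      have "Suc m' * (T + 1) \<le> m * (T + 1)"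
        using s'(3) by (intro mult_right_mono) auto
      hence "1 + t + t' \<le> 1 + m * (T + 1)"
        using s'(2) s''(2) by simp
      thus ?thesis
        unfolding runs_def using exec.WhileT[OF True s'(1) s''(1)] s''(3) by blast
    qed
  qed
  thus ?thesis
    using runs_mono[OF _ assms(3)] assms(4) by blast
qed

text \<open>\<open>b\<close> is the last rank queried or, for \<open>k = 0\<close>, the old value of
  counter 5; quantifying over it avoids a case split. One test, two additions and a query make up
  the \<open>B + 4\<close> per agent.\<close>

lemma runs_rank_sum:
  assumes s: "cnt s 1 = k" "cnt s 4 = 1" "arr s 0 \<subseteq> {..<n}" and d: "d \<notin> {1, 3, 4, 5}"
    and T: "3 + k * (B + 4) \<le> T"
    and Q: "\<And>b. Q (s\<lparr>cnt := (cnt s)(3 := k, 5 := b, d := F (arr s 0))\<rparr>)"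
  shows "runs (rank_sum d) s T Q"
proof -
  define I where "I m s' \<longleftrightarrow> (\<exists>i b. i \<le> k \<and> m = k - i \<and>
    s' = s\<lparr>cnt := (cnt s)(3 := i, 5 := b, d := \<Sum>i=1..i. R i (arr s 0))\<rparr>)" for m s'
  show ?thesis
    unfolding rank_sum_def
  proof (intro runs_Seq_step runs_Const)
    show "runs (While (Less 3 1) (Seq (Add 3 3 4) (Seq (RankQuery 5 3 0) (Add d d 5))))
      (s\<lparr>cnt := (cnt s)(3 := 0), cnt := (cnt (s\<lparr>cnt := (cnt s)(3 := 0)\<rparr>))(d := 0)\<rparr>) (T - 1 - 1) Q"
    proof (rule runs_While[where I = I and T = "B + 3" and m = k])
      fix m s' assume I: "I m s'" "holds (Less 3 1) s'"
      then obtain i b where i: "i < k" "m = k - i"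
          "s' = s\<lparr>cnt := (cnt s)(3 := i, 5 := b, d := \<Sum>i=1..i. R i (arr s 0))\<rparr>"
        using s d by (auto simp: I_def)
      let ?s = "s\<lparr>cnt := (cnt s)(3 := Suc i, 5 := R (Suc i) (arr s 0),
        d := \<Sum>i=1..Suc i. R i (arr s 0))\<rparr>"
      have "I (k - Suc i) ?s"
        unfolding I_def
      proof (rule exI[of _ "Suc i"], rule exI[of _ "R (Suc i) (arr s 0)"])
      qed (use i(1) in auto)
      hence next_state: "\<exists>m'<m. I m' ?s"
        using i by (metis diff_less_mono2 lessI)
      show "runs (Seq (Add 3 3 4) (Seq (RankQuery 5 3 0) (Add d d 5))) s' (B + 3) (\<lambda>s'. \<exists>m'<m. I m' s')"
        unfolding i(3)
      proof (rule runs_Seq_step, rule runs_Add[rotated], rule runs_Seq[where ?T1.0 = "1 + B" and ?T2.0 = 1],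
          rule runs_RankQuery[rotated 3], rule runs_Add[rotated])
      qed (use next_state i(1) d s in \<open>simp_all add: add.commute\<close>)
    next
      show "I k (s\<lparr>cnt := (cnt s)(3 := 0), cnt := (cnt (s\<lparr>cnt := (cnt s)(3 := 0)\<rparr>))(d := 0)\<rparr>)"
      proof -
        have unchanged: "(cnt s)(3 := 0, d := 0) = (cnt s)(3 := 0, 5 := cnt s 5, d := 0)"
          using d by auto
        show ?thesis
          unfolding I_def
        proof (rule exI[of _ 0], rule exI[of _ "cnt s 5"])
        qed (use unchanged in simp)
      qed
    next
      fix m s' assume "I m s'" "\<not> holds (Less 3 1) s'"
      thus "Q s'"
        using Q s d by (auto simp: I_def F_eq)
    qed (use T in \<open>auto simp: algebra_simps\<close>)
  qed (use T in auto)
qed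

text \<open>The time is linear in the multiplier, which is affordable because only gains, at most
  \<open>k\<close>, serve as multipliers.\<close>

lemma runs_scale:
  assumes s: "cnt s 4 = 1" and x: "x \<notin> {4, 8}" "r \<noteq> r'"
    and T: "3 + 3 * cnt s x \<le> T"
    and Q: "Q (s\<lparr>cnt := (cnt s)(8 := cnt s x), reg := (reg s)(r := real (cnt s x) * reg s r')\<rparr>)"
  shows "runs (scale r r' x) s T Q"
proof -
  define I where "I m s' \<longleftrightarrow> (\<exists>i. i \<le> cnt s x \<and> m = cnt s x - i \<and>
    s' = s\<lparr>cnt := (cnt s)(8 := i), reg := (reg s)(r := real i * reg s r')\<rparr>)" for m s'
  show ?thesis
    unfolding scale_def
  proof (intro runs_Seq_step runs_RZero runs_Const)
    show "runs (While (Less 8 x) (Seq (Add 8 8 4) (RAdd r r r')))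
      (s\<lparr>reg := (reg s)(r := 0), cnt := (cnt (s\<lparr>reg := (reg s)(r := 0)\<rparr>))(8 := 0)\<rparr>) (T - 1 - 1) Q"
    proof (rule runs_While[where I = I and T = 2 and m = "cnt s x"])
      fix m s' assume I: "I m s'" "holds (Less 8 x) s'"
      then obtain i where i: "i < cnt s x" "m = cnt s x - i"
          "s' = s\<lparr>cnt := (cnt s)(8 := i), reg := (reg s)(r := real i * reg s r')\<rparr>"
        using x by (auto simp: I_def)
      let ?s = "s\<lparr>cnt := (cnt s)(8 := Suc i), reg := (reg s)(r := real (Suc i) * reg s r')\<rparr>"
      have "I (cnt s x - Suc i) ?s"
        unfolding I_def using i(1) by (intro exI[of _ "Suc i"]) auto
      hence "\<exists>m'<m. I m' ?s"
        using i by (metis diff_less_mono2 lessI)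
      thus "runs (Seq (Add 8 8 4) (RAdd r r r')) s' 2 (\<lambda>s'. \<exists>m'<m. I m' s')"
        unfolding i(3) using x s
        by (intro runs_Seq_step runs_Add runs_RAdd) (simp_all add: algebra_simps)
    next
      show "I (cnt s x) (s\<lparr>reg := (reg s)(r := 0), cnt := (cnt (s\<lparr>reg := (reg s)(r := 0)\<rparr>))(8 := 0)\<rparr>)"
        unfolding I_def by (intro exI[of _ 0]) auto
    next
      fix m s' assume "I m s'" "\<not> holds (Less 8 x) s'"
      thus "Q s'"
        using Q x by (auto simp: I_def)
    qed (use T in \<open>auto simp: algebra_simps\<close>)
  qed (use T in auto)
qed

text \<open>Invariant of the scan over the positions below \<open>j\<close>. At \<open>j = n\<close>
  its cases become "no gain left" and \<open>best A b\<close>, the two outcomes that the main loop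
  needs.\<close>

definition leading :: "nat set \<Rightarrow> nat \<Rightarrow> nat \<Rightarrow> nat \<Rightarrow> real \<Rightarrow> bool" where
  "leading A j g b c \<longleftrightarrow>
     (if g = 0 then \<forall>e<j. e \<notin> A \<longrightarrow> gain A e = 0
      else b < j \<and> b \<notin> A \<and> g = gain A b \<and> c = w b \<and>
        (\<forall>e<j. e \<notin> A \<longrightarrow> real (gain A e) * w b \<le> real g * w e))"

lemma leading_gain_le: "leading A j g b c \<Longrightarrow> g \<le> k"
  by (auto simp: leading_def gain_le split: if_splits)

lemma leading_skip: "leading A j g b c \<Longrightarrow> j \<in> A \<Longrightarrow> leading A (Suc j) g b c"
  by (auto simp: leading_def less_Suc_eq split: if_splits)

text \<open>Earlier gains are all 0, so nonnegative costs suffice for the comparison; if the new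
  gain is 0 as well, the record still means none.\<close>

lemma leading_first:
  assumes "leading A j 0 b c" "j < n" "j \<notin> A"
  shows "leading A (Suc j) (gain A j) j (w j)"
  using assms w_nonneg by (auto simp: leading_def less_Suc_eq)

lemma leading_keep:
  assumes "leading A j g b c" "0 < g" "\<not> real g * w j < real (gain A j) * c"
  shows "leading A (Suc j) g b c"
  using assms by (auto simp: leading_def less_Suc_eq)

text \<open>Transitivity of the cross-multiplied order requires cancelling the old candidate's cost
  \<open>w b\<close>. The strict inequality permits it: its right side is positive, hence so are
  \<open>w b\<close> and the new gain.\<close>

lemma leading_replace:
  assumes lead: "leading A j g b c" "0 < g" and j: "j < n" "j \<notin> A"
    and better: "real g * w j < real (gain A j) * c"
  shows "leading A (Suc j) (gain A j) j (w j)"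
proof -
  have b: "b < j" "c = w b" and le: "\<And>e. e < j \<Longrightarrow> e \<notin> A \<Longrightarrow> gain A e * w b \<le> g * w e"
    using lead by (auto simp: leading_def)
  have wj: "0 \<le> w j" and wb: "0 \<le> w b"
    using w_nonneg b(1) j(1) by auto
  have "0 < gain A j * w b"
    using better wj b(2) by (smt (verit) mult_nonneg_nonneg of_nat_0_le_iff)
  hence pos: "0 < gain A j" "0 < w b"
    using wb by (auto simp: zero_less_mult_iff)
  have "gain A e * w j \<le> gain A j * w e" if e: "e < j" "e \<notin> A" for e
  proof -
    have we: "0 \<le> w e"
      using w_nonneg e(1) j(1) by simp
    have "(gain A e * w j) * w b = (gain A e * w b) * w j"
      by simp
    also have "\<dots> \<le> (g * w e) * w j"
      using le[OF e] wj by (rule mult_right_mono)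
    also have "\<dots> = (g * w j) * w e"
      by simp
    also have "\<dots> \<le> (gain A j * w b) * w e"
      using better b(2) we by (intro mult_right_mono) auto
    also have "\<dots> = (gain A j * w e) * w b"
      by simp
    finally show ?thesis
      using pos(2) by simp
  qed
  thus ?thesis
    using pos j by (auto simp: leading_def less_Suc_eq)
qed

section \<open>One scan over all positions\<close>

definition ready :: "nat set \<Rightarrow> config \<Rightarrow> bool" where
  "ready A s \<longleftrightarrow> cnt s 0 = n \<and> cnt s 1 = k \<and> cnt s 4 = 1 \<and> cnt s 11 = 0 \<and> arr s 0 = A \<and> A \<subseteq> {..<n}"

definition scanned :: "nat set \<Rightarrow> nat \<Rightarrow> config \<Rightarrow> bool" where
  "scanned A j s \<longleftrightarrow> ready A s \<and> j \<le> n \<and> cnt s 2 = j \<and> cnt s 6 = F A \<and>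
     leading A j (cnt s 9) (cnt s 10) (reg s 1)"

lemma runs_select:
  assumes "5 \<le> T"
    and "Q (s\<lparr>cnt := (cnt s)(9 := cnt s 7, 10 := cnt s 2), reg := (reg s)(1 := w (cnt s 2))\<rparr>)"
  shows "runs select s T Q"
  unfolding select_def using assms
  by (intro runs_Seq_step runs_Const runs_Add runs_LoadCost) simp_all

text \<open>The postcondition describes the state after counter 2 is incremented: the candidate
  already accounts for \<open>j\<close>, while the increment is left to \<open>scan\<close>. The
  term \<open>k * (B + 10)\<close> covers a rank sum and two products with multipliers at most
  \<open>k\<close>.\<close>

lemma runs_examine:
  assumes s: "scanned A j s" and j: "j < n" "j \<notin> A" and T: "20 + k * (B + 10) \<le> T"
  shows "runs examine s T (\<lambda>s'. scanned A (Suc j) (s'\<lparr>cnt := (cnt s')(2 := Suc j)\<rparr>) \<and> cnt s' 2 = j)"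
    (is "runs _ _ _ ?Q")
proof -
  have ready: "cnt s 0 = n" "cnt s 1 = k" "cnt s 4 = 1" "cnt s 11 = 0" "arr s 0 = A" "A \<subseteq> {..<n}"
    and c2: "cnt s 2 = j" and c6: "cnt s 6 = F A"
    and lead: "leading A j (cnt s 9) (cnt s 10) (reg s 1)"
    using s by (auto simp: scanned_def ready_def)
  have g9: "cnt s 9 \<le> k" and gj: "gain A j \<le> k"
    using leading_gain_le[OF lead] gain_le by auto
  define s1 where "s1 = s\<lparr>arr := (arr s)(0 := insert j A)\<rparr>"
  define s2 where "s2 b = s\<lparr>arr := (arr s)(0 := A), cnt := (cnt s)(3 := k, 5 := b, 7 := gain A j),
    reg := (reg s)(0 := w j)\<rparr>" for b
  define s3 where "s3 b = (s2 b)\<lparr>cnt := (cnt (s2 b))(8 := gain A j),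
    reg := (reg (s2 b))(2 := real (cnt s 9) * w j, 3 := real (gain A j) * reg s 1)\<rparr>" for b
  let ?D = "3 + k * (B + 4)"
  have tail: "runs (Cond (Less 11 9) (Seq (scale 2 0 9) (Seq (scale 3 1 7) (Cond (RLess 2 3) select Skip)))
      select) (s2 b) (13 + 6 * k) ?Q" for b
  proof (rule runs_Cond)
    assume "\<not> holds (Less 11 9) (s2 b)"
    hence z: "cnt s 9 = 0"
      using ready by (simp add: s2_def)
    show "runs select (s2 b) (13 + 6 * k - 1) ?Q"
      using ready c2 c6 j leading_first[of A j] lead z
      by (intro runs_select) (simp_all add: s2_def scanned_def ready_def)
  next
    assume "holds (Less 11 9) (s2 b)"
    hence pos: "0 < cnt s 9"
      using ready by (simp add: s2_def)
    have last: "runs (Cond (RLess 2 3) select Skip) (s3 b) 6 ?Q"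
    proof (rule runs_Cond)
      assume "holds (RLess 2 3) (s3 b)"
      hence "real (cnt s 9) * w j < real (gain A j) * reg s 1"
        by (simp add: s3_def)
      from leading_replace[OF lead pos j this]
      show "runs select (s3 b) (6 - 1) ?Q"
        using ready c2 c6 j
        by (intro runs_select) (simp_all add: s2_def s3_def scanned_def ready_def)
    next
      assume "\<not> holds (RLess 2 3) (s3 b)"
      hence "\<not> real (cnt s 9) * w j < real (gain A j) * reg s 1"
        by (simp add: s3_def)
      from leading_keep[OF lead pos this]
      show "runs Skip (s3 b) (6 - 1) ?Q"
        using ready c2 c6 j
        by (intro runs_Skip) (simp_all add: s2_def s3_def scanned_def ready_def)
    qed simp
    show "runs (Seq (scale 2 0 9) (Seq (scale 3 1 7) (Cond (RLess 2 3) select Skip)))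
        (s2 b) (13 + 6 * k - 1) ?Q"
    proof (rule runs_Seq[where ?T1.0 = "3 + 3 * k" and ?T2.0 = "9 + 3 * k"], rule runs_scale)
      show "runs (Seq (scale 3 1 7) (Cond (RLess 2 3) select Skip))
        (s2 b\<lparr>cnt := (cnt (s2 b))(8 := cnt (s2 b) 9),
          reg := (reg (s2 b))(2 := real (cnt (s2 b) 9) * reg (s2 b) 0)\<rparr>) (9 + 3 * k) ?Q"
      proof (rule runs_Seq[where ?T1.0 = "3 + 3 * k" and ?T2.0 = 6], rule runs_scale)
      qed (use last ready g9 gj in \<open>simp_all add: s2_def s3_def\<close>)
    qed (use ready g9 in \<open>simp_all add: s2_def\<close>)
  qed simp
  \<comment> \<open>\<open>Remove\<close> restores \<open>A\<close> because \<open>j\<close> is not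
    in it, and \<open>Sub\<close> leaves the gain in counter 7.\<close>
  have rest: "runs (Seq (Remove 2 0) (Seq (Sub 7 7 6) (Seq (LoadCost 0 2)
     (Cond (Less 11 9)
       (Seq (scale 2 0 9) (Seq (scale 3 1 7) (Cond (RLess 2 3) select Skip)))
       select)))) (s1\<lparr>cnt := (cnt s1)(3 := k, 5 := b, 7 := F (arr s1 0))\<rparr>) (16 + 6 * k) ?Q" for b
    using tail[of b] c2 c6 j ready
    by (intro runs_Seq_step runs_Remove runs_Sub runs_LoadCost)
       (simp_all add: s1_def s2_def f_insert)
  have ranked: "runs (Seq (rank_sum 7) (Seq (Remove 2 0) (Seq (Sub 7 7 6) (Seq (LoadCost 0 2)
     (Cond (Less 11 9)
       (Seq (scale 2 0 9) (Seq (scale 3 1 7) (Cond (RLess 2 3) select Skip)))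
       select))))) s1 (T - 1) ?Q"
  proof (rule runs_Seq[where ?T1.0 = ?D and ?T2.0 = "16 + 6 * k"], rule runs_rank_sum)
    show "runs (Seq (Remove 2 0) (Seq (Sub 7 7 6) (Seq (LoadCost 0 2)
     (Cond (Less 11 9)
       (Seq (scale 2 0 9) (Seq (scale 3 1 7) (Cond (RLess 2 3) select Skip)))
       select)))) (s1\<lparr>cnt := (cnt s1)(3 := k, 5 := b, 7 := F (arr s1 0))\<rparr>) (16 + 6 * k) ?Q" for b
      by (rule rest)
  qed (use ready j T in \<open>auto simp: s1_def algebra_simps\<close>)
  show ?thesis
    unfolding examine_def
  proof (rule runs_Seq_step, rule runs_Insert)
  qed (use ranked T c2 ready in \<open>simp_all add: s1_def\<close>)
qed

lemma runs_scan:
  assumes s: "ready A s" and T: "6 + k * (B + 4) + n * (23 + k * (B + 10)) \<le> T"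
  shows "runs scan s T (scanned A n)"
proof -
  let ?D = "3 + k * (B + 4)" and ?X = "20 + k * (B + 10)"
  define I where "I m s' \<longleftrightarrow> (\<exists>j\<le>n. m = n - j \<and> scanned A j s')" for m s'
  have loop: "runs (While (Less 2 0) (Seq (Cond (Member 2 0) Skip examine) (Add 2 2 4))) s'
      (1 + n * (?X + 2 + 1)) (scanned A n)" if "scanned A 0 s'" for s'
  proof (rule runs_While[where I = I and T = "?X + 2" and m = n])
    fix m s' assume I: "I m s'" "holds (Less 2 0) s'"
    then obtain j where j: "m = n - j" "scanned A j s'" "j < n"
      by (auto simp: I_def scanned_def ready_def)
    have step: "\<exists>m'<m. I m' s''" if "scanned A (Suc j) s''" for s''
    proof (intro exI conjI)
      show "I (n - Suc j) s''"
        unfolding I_def using that j by (intro exI[of _ "Suc j"]) auto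
    qed (use j in auto)
    show "runs (Seq (Cond (Member 2 0) Skip examine) (Add 2 2 4)) s' (?X + 2) (\<lambda>s'. \<exists>m'<m. I m' s')"
    proof (rule runs_Seq[where ?T1.0 = "?X + 1" and ?T2.0 = 1], rule runs_Cond)
      assume "holds (Member 2 0) s'"
      hence "j \<in> A"
        using j(2) by (simp add: scanned_def ready_def)
      hence "scanned A (Suc j) (s'\<lparr>cnt := (cnt s')(2 := Suc j)\<rparr>)"
        using j(2,3) by (simp add: scanned_def ready_def leading_skip)
      thus "runs Skip s' (?X + 1 - 1) (\<lambda>s'. runs (Add 2 2 4) s' 1 (\<lambda>s'. \<exists>m'<m. I m' s'))"
        using j(2) step by (intro runs_Skip runs_Add) (simp_all add: scanned_def ready_def)
    next
      assume "\<not> holds (Member 2 0) s'"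
      hence "j \<notin> A"
        using j(2) by (simp add: scanned_def ready_def)
      from runs_examine[OF j(2,3) this order_refl]
      show "runs examine s' (?X + 1 - 1) (\<lambda>s'. runs (Add 2 2 4) s' 1 (\<lambda>s'. \<exists>m'<m. I m' s'))"
      proof (rule runs_mono)
        fix s'' assume s'': "scanned A (Suc j) (s''\<lparr>cnt := (cnt s'')(2 := Suc j)\<rparr>) \<and> cnt s'' 2 = j"
        hence "cnt s'' 4 = 1"
          by (simp add: scanned_def ready_def)
        thus "runs (Add 2 2 4) s'' 1 (\<lambda>s'. \<exists>m'<m. I m' s')"
          using s'' step by (intro runs_Add) simp_all
      qed simp
    qed simp_all
  next
    show "I n s'"
      unfolding I_def using that by (intro exI[of _ 0]) simp
  next
    fix m s' assume "I m s'" "\<not> holds (Less 2 0) s'"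
    thus "scanned A n s'"
      by (auto simp: I_def scanned_def ready_def)
  qed simp
  show ?thesis
    unfolding scan_def
  proof (rule runs_Seq[where ?T1.0 = ?D and ?T2.0 = "3 + n * (?X + 2 + 1)"], rule runs_rank_sum)
    fix b
    show "runs (Seq (Const 9 0) (Seq (Const 2 0)
       (While (Less 2 0) (Seq (Cond (Member 2 0) Skip examine) (Add 2 2 4)))))
       (s\<lparr>cnt := (cnt s)(3 := k, 5 := b, 6 := F (arr s 0))\<rparr>) (3 + n * (?X + 2 + 1)) (scanned A n)"
    proof (intro runs_Seq_step runs_Const)
      show "runs (While (Less 2 0) (Seq (Cond (Member 2 0) Skip examine) (Add 2 2 4)))
        (s\<lparr>cnt := (cnt s)(3 := k, 5 := b, 6 := F (arr s 0)),
           cnt := (cnt (s\<lparr>cnt := (cnt s)(3 := k, 5 := b, 6 := F (arr s 0))\<rparr>))(9 := 0),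
           cnt := (cnt (s\<lparr>cnt := (cnt s)(3 := k, 5 := b, 6 := F (arr s 0)),
             cnt := (cnt (s\<lparr>cnt := (cnt s)(3 := k, 5 := b, 6 := F (arr s 0))\<rparr>))(9 := 0)\<rparr>))(2 := 0)\<rparr>)
        (3 + n * (?X + 2 + 1) - 1 - 1) (scanned A n)"
        by (rule runs_mono[OF loop]) (use s in \<open>simp_all add: scanned_def ready_def leading_def\<close>)
    qed simp_all
  qed (use s T in \<open>simp_all add: ready_def\<close>)
qed

lemma runs_greedy_program:
  assumes T: "3 + (n + 1) * (9 + k * (B + 4) + n * (23 + k * (B + 10))) \<le> T"
  shows "runs greedy_program (initial n k) T (\<lambda>s. arr s 0 \<subseteq> {..<n} \<and>
    (\<lambda>A B. \<exists>e. best A e \<and> B = insert e A)\<^sup>*\<^sup>* {} (arr s 0) \<and> \<not> F (arr s 0) < F {..<n})"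
    (is "runs _ _ _ ?Q")
proof -
  let ?S = "6 + k * (B + 4) + n * (23 + k * (B + 10))"
  define reach where "reach = (\<lambda>A B. \<exists>e. best A e \<and> B = insert e A)\<^sup>*\<^sup>* {}"
  \<comment> \<open>The \<open>+ 1\<close> keeps the variant positive even when \<open>A\<close> is
    everything, leaving room for the last scan, which finds no gain and drops the variant to
    0.\<close>
  define I where "I m s \<longleftrightarrow> (\<exists>A. ready A s \<and> reach A \<and>
    (if cnt s 9 = 0 then m = 0 \<and> \<not> F A < F {..<n} else m = n + 1 - card A))" for m s
  show ?thesis
    unfolding greedy_program_def
  proof (intro runs_Seq_step runs_Const)
    show "runs (While (Less 11 9) (Seq scan (Cond (Less 11 9) (Insert 10 0) Skip)))
      (initial n k\<lparr>cnt := (cnt (initial n k))(4 := 1),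
        cnt := (cnt (initial n k\<lparr>cnt := (cnt (initial n k))(4 := 1)\<rparr>))(9 := 1)\<rparr>) (T - 1 - 1) ?Q"
    proof (rule runs_While[where I = I and T = "?S + 2" and m = "n + 1"])
      fix m s assume I: "I m s" "holds (Less 11 9) s"
      then obtain A where A: "ready A s" "reach A" "m = n + 1 - card A"
        by (auto simp: I_def ready_def split: if_splits)
      have An: "A \<subseteq> {..<n}"
        using A(1) by (simp add: ready_def)
      have cA: "card A \<le> n"
        using card_mono[OF _ An] by simp
      show "runs (Seq scan (Cond (Less 11 9) (Insert 10 0) Skip)) s (?S + 2) (\<lambda>s'. \<exists>m'<m. I m' s')"
      proof (rule runs_Seq[where ?T1.0 = ?S and ?T2.0 = 2], rule runs_mono[OF runs_scan[OF A(1) order_refl]])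
        fix s' assume s': "scanned A n s'"
        hence r: "ready A s'" and lead: "leading A n (cnt s' 9) (cnt s' 10) (reg s' 1)"
          by (auto simp: scanned_def)
        show "runs (Cond (Less 11 9) (Insert 10 0) Skip) s' 2 (\<lambda>s'. \<exists>m'<m. I m' s')"
        proof (rule runs_Cond)
          assume "holds (Less 11 9) s'"
          hence pos: "0 < cnt s' 9"
            using r by (simp add: ready_def)
          let ?e = "cnt s' 10" and ?s = "s'\<lparr>arr := (arr s')(0 := arr s' 0 \<union> {cnt s' 10})\<rparr>"
          have e: "best A ?e"
            using lead pos by (auto simp: leading_def best_def)
          have eA: "?e < n" "?e \<notin> A"
            using e by (auto simp: best_def)
          have "reach (insert ?e A)"
            using e unfolding reach_def
            by (intro rtranclp.rtrancl_into_rtrancl[OF A(2)[unfolded reach_def]]) blast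
          moreover have "ready (insert ?e A) ?s"
            using r eA by (auto simp: ready_def)
          ultimately have "I (n + 1 - card (insert ?e A)) ?s"
            unfolding I_def using pos by (intro exI[of _ "insert ?e A"]) simp
          moreover have "n + 1 - card (insert ?e A) < m"
            using eA(2) finite_subset[OF An] cA A(3) by simp
          ultimately show "runs (Insert 10 0) s' (2 - 1) (\<lambda>s'. \<exists>m'<m. I m' s')"
            by (intro runs_Insert) auto
        next
          assume "\<not> holds (Less 11 9) s'"
          hence z: "cnt s' 9 = 0"
            using r by (simp add: ready_def)
          hence "\<not> F A < F {..<n}"
            using lead complete_iff_gain_eq_0[OF An] by (auto simp: leading_def)
          hence "I 0 s'"
            unfolding I_def using r A(2) z by auto
          moreover have "0 < m"
            using A(3) cA by simp
          ultimately show "runs Skip s' (2 - 1) (\<lambda>s'. \<exists>m'<m. I m' s')"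
            by (intro runs_Skip) auto
        qed simp
      qed simp_all
    next
      show "I (n + 1) (initial n k\<lparr>cnt := (cnt (initial n k))(4 := 1),
        cnt := (cnt (initial n k\<lparr>cnt := (cnt (initial n k))(4 := 1)\<rparr>))(9 := 1)\<rparr>)"
        unfolding I_def by (intro exI[of _ "{}"]) (simp add: ready_def reach_def initial_def)
    next
      fix m s assume "I m s" "\<not> holds (Less 11 9) s"
      thus "?Q s"
        by (auto simp: I_def ready_def reach_def)
    next
      have "?S + 2 + 1 = 9 + k * (B + 4) + n * (23 + k * (B + 10))"
        by simp
      thus "1 + (n + 1) * (?S + 2 + 1) \<le> T - 1 - 1"
        using T by (simp only:)
    qed
  qed (use T in simp_all)
qed

end

section \<open>Rank-ratio-greedy\<close>

lemma submodular_cover_total_rank: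
  assumes "cover_instance E k \<I> c"
  shows "submodular_cover E (total_rank k \<I>) (\<lambda>e. c {e})"
proof
  have M: "matroid E (\<I> i)" if "i \<in> {1..k}" for i
    using assms that by (simp add: cover_instance_def)
  show "finite E"
    using assms by (simp add: cover_instance_def)
  show "total_rank k \<I> A \<le> total_rank k \<I> B" if "A \<subseteq> B" for A B
    unfolding total_rank_def using mrank_mono[OF M that] by (rule sum_mono)
  show "total_rank k \<I> (insert e B) + total_rank k \<I> A \<le>
      total_rank k \<I> (insert e A) + total_rank k \<I> B" if "A \<subseteq> B" for A B e
    unfolding total_rank_def sum.distrib[symmetric]
    using mrank_diminishing[OF M that] by (rule sum_mono)
  show "0 \<le> c {e}" if "e \<in> E" for e
    using assms that by (simp add: cover_instance_def)
qed

text \<open>No agent's rank exceeds its full rank, so equal sums force equality agent by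
  agent.\<close>

lemma feasible_iff_total_rank:
  assumes "cover_instance E k \<I> c" "S \<subseteq> E"
  shows "feasible E k \<I> S \<longleftrightarrow> total_rank k \<I> S = total_rank k \<I> E"
proof
  assume eq: "total_rank k \<I> S = total_rank k \<I> E"
  have "mrank (\<I> i) S = mrank (\<I> i) E" if "i \<in> {1..k}" for i
  proof (rule sum_mono_inv[OF eq[unfolded total_rank_def]])
    show "mrank (\<I> i) S \<le> mrank (\<I> i) E" if "i \<in> {1..k}" for i
      using assms that by (intro mrank_mono) (auto simp: cover_instance_def)
  qed (use that in auto)
  thus "feasible E k \<I> S"
    using assms(2) by (simp add: feasible_def)
qed (simp add: feasible_def total_rank_def)

lemma ratio_le_imp_cross_le:
  assumes "0 \<le> a" "0 \<le> b" "0 \<le> g" "0 \<le> h"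
    and "1 / ereal a * ereal g \<le> 1 / ereal b * ereal h"
  shows "g * b \<le> h * a"
proof -
  consider "b = 0" | "b > 0" "a = 0" | "a > 0" "b > 0"
    using assms by linarith
  thus ?thesis
  proof cases
    case 2
    hence "\<not> 0 < g"
      using assms(5) by (auto simp: zero_ereal_def divide_ereal_def)
    thus ?thesis
      using 2 assms(3) by simp
  next
    case 3
    thus ?thesis
      using assms(5) by (simp add: field_simps one_ereal_def)
  qed (use assms in simp)
qed

text \<open>The positive \<open>h\<close> matters at \<open>b = 0\<close>: there the
  cross-multiplied inequality says nothing, and the right ratio is infinite for \<open>h > 0\<close>
  but would be 0 for \<open>h = 0\<close>.\<close>

lemma cross_le_imp_ratio_le:
  assumes "0 \<le> a" "0 \<le> b" "0 \<le> g" "0 < h" and le: "g * b \<le> h * a"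
  shows "1 / ereal a * ereal g \<le> 1 / ereal b * ereal h"
proof -
  consider "b = 0" | "b > 0" "a = 0" | "a > 0" "b > 0"
    using assms by linarith
  thus ?thesis
  proof cases
    case 1
    thus ?thesis
      using assms(4) by (simp add: divide_ereal_def zero_ereal_def)
  next
    case 2
    hence "g = 0"
      using assms by (simp add: mult_le_0_iff)
    thus ?thesis
      using 2 assms(4) by (simp add: one_ereal_def)
  next
    case 3
    thus ?thesis
      using le by (simp add: field_simps one_ereal_def)
  qed
qed

text \<open>Forward, an incomplete \<open>H\<close> leaves an element of positive gain, hence of
  positive ratio, so the maximizer cannot have gain 0. Backward, a positive gain certifies
  incompleteness.\<close>

lemma greedy_step_iff_best:
  assumes inst: "cover_instance E k \<I> c" and H: "H \<subseteq> E"
  shows "greedy_step E k \<I> c H H' \<longleftrightarrow>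
    (\<exists>e. submodular_cover.best E (total_rank k \<I>) (\<lambda>e. c {e}) H e \<and> H' = insert e H)"
proof -
  interpret submodular_cover E "total_rank k \<I>" "\<lambda>e. c {e}"
    by (rule submodular_cover_total_rank[OF inst])
  have ratio: "rank_ratio k \<I> c H e = 1 / ereal (c {e}) * ereal (real (gain H e))" for e
    by (simp add: rank_ratio_def f_insert)
  show ?thesis
  proof
    assume "greedy_step E k \<I> c H H'"
    then obtain e where lt: "total_rank k \<I> H < total_rank k \<I> E"
        and e: "is_arg_max (rank_ratio k \<I> c H) (\<lambda>e. e \<in> E - H) e" and H': "H' = H \<union> {e}"
      by cases auto
    have eE: "e \<in> E - H" and max: "\<And>x. x \<in> E - H \<Longrightarrow> rank_ratio k \<I> c H x \<le> rank_ratio k \<I> c H e"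
      using e by (auto simp: is_arg_max_linorder)
    obtain x where x: "x \<in> E - H" "0 < gain H x"
      using complete_iff_gain_eq_0[OF H] lt by blast
    have "0 < gain H e"
    proof (rule ccontr)
      assume "\<not> 0 < gain H e"
      hence "1 / ereal (c {x}) * ereal (real (gain H x)) \<le> 0"
        using max[OF x(1)] by (simp add: ratio zero_ereal_def[symmetric])
      moreover have "0 < 1 / ereal (c {x}) * ereal (real (gain H x))"
        using x w_nonneg[of x] by (cases "c {x} = 0") (auto simp: divide_ereal_def one_ereal_def zero_ereal_def)
      ultimately show False
        by simp
    qed
    moreover have "real (gain H x) * c {e} \<le> real (gain H e) * c {x}" if "x \<in> E - H" for x
      using max[OF that] that eE w_nonneg unfolding ratio by (intro ratio_le_imp_cross_le) auto
    ultimately have "best H e"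
      using eE by (simp add: best_def)
    thus "\<exists>e. best H e \<and> H' = insert e H"
      using H' by auto
  next
    assume "\<exists>e. best H e \<and> H' = insert e H"
    then obtain e where e: "best H e" "H' = insert e H"
      by blast
    have lt: "total_rank k \<I> H < total_rank k \<I> E"
      using complete_iff_gain_eq_0[OF H] e(1) by (auto simp: best_def)
    have "rank_ratio k \<I> c H x \<le> rank_ratio k \<I> c H e" if "x \<in> E - H" for x
      unfolding ratio using e(1) that w_nonneg
      by (intro cross_le_imp_ratio_le) (auto simp: best_def)
    hence "is_arg_max (rank_ratio k \<I> c H) (\<lambda>e. e \<in> E - H) e"
      using e(1) by (auto simp: is_arg_max_linorder best_def)
    from greedy_step.intros[of k \<I> H E c, OF lt this] show "greedy_step E k \<I> c H H'"
      using e(2) by simp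
  qed
qed

lemma greedy_run_subset:
  assumes "(greedy_step E k \<I> c)\<^sup>*\<^sup>* {} H"
  shows "H \<subseteq> E"
  using assms
proof induction
  case (step H H')
  from step.hyps(2) step.IH show ?case
    by cases (auto simp: is_arg_max_def)
qed simp

lemma greedy_run_best:
  assumes inst: "cover_instance E k \<I> c" and "(greedy_step E k \<I> c)\<^sup>*\<^sup>* {} H"
  shows "(\<lambda>A B. \<exists>e. submodular_cover.best E (total_rank k \<I>) (\<lambda>e. c {e}) A e \<and> B = insert e A)\<^sup>*\<^sup>* {} H"
  using assms(2)
proof induction
  case (step H H')
  show ?case
    using greedy_step_iff_best[OF inst greedy_run_subset[OF step.hyps(1)]] step.hyps(2)
    by (intro rtranclp.rtrancl_into_rtrancl[OF step.IH]) blast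
qed simp

text \<open>The induction starts at singletons: for the empty set the sum is 0, but
  \<open>c {}\<close> may be positive.\<close>

lemma cost_le_sum:
  assumes inst: "cover_instance E k \<I> c" and "H \<subseteq> E" "H \<noteq> {}"
  shows "c H \<le> (\<Sum>e\<in>H. c {e})"
proof -
  have "finite H"
    using inst assms(2) finite_subset by (auto simp: cover_instance_def)
  thus ?thesis
    using assms(3,2)
  proof (induction rule: finite_ne_induct)
    case (insert x A)
    have sub: "c S + c T \<ge> c (S \<union> T) + c (S \<inter> T)" if "S \<subseteq> E" "T \<subseteq> E" for S T
      using inst that by (simp add: cover_instance_def submodular_on_def)
    have "0 \<le> c ({x} \<inter> A)"
      using inst insert.prems by (simp add: cover_instance_def le_infI2)
    moreover have "c A \<le> (\<Sum>e\<in>A. c {e})"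
      using insert.IH insert.prems by simp
    ultimately show ?case
      using sub[of "{x}" A] insert.prems insert.hyps by simp
  qed simp
qed

lemma greedy_approximation:
  assumes inst: "cover_instance E k \<I> c" and out: "greedy_output E k \<I> c H"
  shows "feasible E k \<I> H"
    and "2 \<le> k \<Longrightarrow> (feasible E k \<I> {} \<longrightarrow> c {} = 0) \<Longrightarrow> gamma_ratio E k \<I> c < \<infinity> \<Longrightarrow>
      approx_solution E k \<I> c
        ((1 + 1 / ln 2) * (real_of_ereal (gamma_ratio E k \<I> c) * ln (real k))) H"
proof -
  interpret submodular_cover E "total_rank k \<I>" "\<lambda>e. c {e}"
    by (rule submodular_cover_total_rank[OF inst])
  have run: "(greedy_step E k \<I> c)\<^sup>*\<^sup>* {} H" and complete: "\<not> total_rank k \<I> H < total_rank k \<I> E"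
    using out by (auto simp: greedy_output_def)
  have HE: "H \<subseteq> E"
    by (rule greedy_run_subset[OF run])
  have full: "total_rank k \<I> H = total_rank k \<I> E"
    using f_mono[OF HE] complete by simp
  show feas: "feasible E k \<I> H"
    using feasible_iff_total_rank[OF inst HE] full by simp
  assume k: "2 \<le> k" and empty: "feasible E k \<I> {} \<longrightarrow> c {} = 0" and fin: "gamma_ratio E k \<I> c < \<infinity>"
  let ?ratio = "\<lambda>S. ereal (\<Sum>e\<in>S. c {e}) / ereal (c S)"
  let ?\<gamma> = "gamma_ratio E k \<I> c"
  have finF: "finite (Collect (feasible E k \<I>))"
    by (rule finite_subset[of _ "Pow E"]) (auto simp: feasible_def finite_E)
  have "E \<in> Collect (feasible E k \<I>)"
    by (simp add: feasible_def)
  hence "\<exists>S. optimal E k \<I> c S"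
    using ex_is_arg_min_if_finite[OF finF, of c] by (auto simp: optimal_def)
  moreover have "finite {S. optimal E k \<I> c S}"
    by (rule finite_subset[OF _ finF]) (auto simp: optimal_def is_arg_min_def)
  ultimately have "?\<gamma> \<in> ?ratio ` {S. optimal E k \<I> c S}"
    unfolding gamma_ratio_def by (intro Min_in) auto
  then obtain S where S: "optimal E k \<I> c S" "?\<gamma> = ?ratio S"
    by blast
  have SE: "S \<subseteq> E" "feasible E k \<I> S"
    using S(1) by (auto simp: optimal_def is_arg_min_def feasible_def)
  have sum0: "0 \<le> (\<Sum>e\<in>S. c {e})"
    using SE(1) w_nonneg by (intro sum_nonneg) auto
  have cS: "0 \<le> c S"
    using inst SE(1) by (simp add: cover_instance_def)
  \<comment> \<open>At \<open>c S = 0\<close> the ratio is infinite unless the sum is 0, so a finite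
    gamma makes both sides 0.\<close>
  have sum_eq: "(\<Sum>e\<in>S. c {e}) = real_of_ereal ?\<gamma> * c S"
  proof (cases "c S = 0")
    case True
    hence "\<not> 0 < (\<Sum>e\<in>S. c {e})"
      using fin S(2) by (auto simp: divide_ereal_def zero_ereal_def)
    thus ?thesis
      using True sum0 by simp
  next
    case False
    thus ?thesis
      using S(2) by simp
  qed
  have \<gamma>0: "0 \<le> real_of_ereal ?\<gamma>"
    unfolding S(2) divide_ereal_def using sum0 cS by (intro real_of_ereal_pos ereal_0_le_mult) auto
  have harm: "harm k \<le> (1 + 1 / ln 2) * ln (real k)"
  proof -
    \<comment> \<open>\<open>harm k - ln k\<close> is decreasing in \<open>k\<close> and equals 1 at
      \<open>k = 1\<close>.\<close>
    have "harm k \<le> 1 + ln (real k)"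
      using euler_mascheroni_sequence_decreasing[of 1 k] k by (simp add: harm_def)
    moreover have "1 \<le> 1 / ln 2 * ln (real k)"
      using k by simp
    ultimately show ?thesis
      unfolding distrib_right mult_1_left by linarith
  qed
  have gain_le: "gain {} e \<le> k" for e
  proof -
    have "total_rank k \<I> {e} \<le> (\<Sum>i=1..k. mrank (\<I> i) {} + 1)"
      unfolding total_rank_def using inst mrank_insert_le[of E _ e "{}"]
      by (intro sum_mono) (auto simp: cover_instance_def)
    also have "\<dots> = total_rank k \<I> {} + k"
      by (simp only: sum.distrib total_rank_def) simp
    finally show ?thesis
      by (simp add: gain_def)
  qed
  have sum_le: "(\<Sum>e\<in>H. c {e}) \<le> harm k * (\<Sum>e\<in>S. c {e})"
    using greedy_cost[OF greedy_run_best[OF inst run] full SE(1) _ gain_le]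
      feasible_iff_total_rank[OF inst SE(1)] SE(2) by simp
  have "c H \<le> (\<Sum>e\<in>H. c {e})"
  proof (cases "H = {}")
    case True
    thus ?thesis
      using empty feas by simp
  qed (use cost_le_sum[OF inst HE] in simp)
  also have "\<dots> \<le> harm k * (real_of_ereal ?\<gamma> * c S)"
    using sum_le sum_eq by simp
  also have "\<dots> \<le> ((1 + 1 / ln 2) * ln (real k)) * (real_of_ereal ?\<gamma> * c S)"
    using harm \<gamma>0 cS by (intro mult_right_mono) auto
  finally have bound: "c H \<le> (1 + 1 / ln 2) * (real_of_ereal ?\<gamma> * ln (real k)) * c S"
    by (simp add: mult_ac)
  \<comment> \<open>All optimal sets cost the same, so the bound for \<open>S\<close> serves every
    one of them.\<close>
  have "c S' = c S" if "optimal E k \<I> c S'" for S'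
    using that S(1) by (auto simp: optimal_def is_arg_min_linorder intro: order_antisym)
  thus "approx_solution E k \<I> c ((1 + 1 / ln 2) * (real_of_ereal ?\<gamma> * ln (real k))) H"
    using feas bound by (simp add: approx_solution_def)
qed

text \<open>Gains agree because \<open>F\<close> is the total rank of the image; distinctness makes
  the positions outside \<open>A\<close> match exactly the elements outside that image.\<close>

lemma best_reindex:
  assumes inst: "cover_instance (set es) k \<I> c" and dist: "distinct es"
    and F: "F = (\<lambda>A. total_rank k \<I> ((!) es ` A))"
    and sc: "submodular_cover {..<length es} F (\<lambda>j. c {es ! j})"
    and best: "submodular_cover.best {..<length es} F (\<lambda>j. c {es ! j}) A j" and A: "A \<subseteq> {..<length es}"
  shows "submodular_cover.best (set es) (total_rank k \<I>) (\<lambda>e. c {e}) ((!) es ` A) (es ! j)"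
proof -
  interpret S: submodular_cover "set es" "total_rank k \<I>" "\<lambda>e. c {e}"
    by (rule submodular_cover_total_rank[OF inst])
  interpret I: submodular_cover "{..<length es}" F "\<lambda>j. c {es ! j}"
    by (rule sc)
  have gain: "I.gain A i = S.gain ((!) es ` A) (es ! i)" for i
    unfolding I.gain_def S.gain_def by (simp add: F)
  have "inj_on ((!) es) {..<length es}"
    using dist by (simp add: inj_on_nth)
  moreover have "set es = (!) es ` {..<length es}"
    by (auto simp: in_set_conv_nth)
  ultimately have "set es - (!) es ` A = (!) es ` ({..<length es} - A)"
    using A by (simp add: inj_on_image_set_diff)
  thus ?thesis
    using best by (auto simp: I.best_def S.best_def gain)
qed

lemma rank_machine_total_rank:
  assumes inst: "cover_instance (set es) k \<I> c"
    and time: "\<And>i A. i \<in> {1..k} \<Longrightarrow> A \<subseteq> {..<length es} \<Longrightarrow> \<tau> i A \<le> B"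
  shows "rank_machine (length es) (\<lambda>A. total_rank k \<I> ((!) es ` A)) (\<lambda>j. c {es ! j})
    (\<lambda>i A. mrank (\<I> i) ((!) es ` A)) \<tau> k B"
proof -
  interpret S: submodular_cover "set es" "total_rank k \<I>" "\<lambda>e. c {e}"
    by (rule submodular_cover_total_rank[OF inst])
  show ?thesis
  proof
    show "mrank (\<I> i) ((!) es ` insert j A) \<le> Suc (mrank (\<I> i) ((!) es ` A))"
      if "i \<in> {1..k}" for i j A
      using inst that mrank_insert_le[of "set es" "\<I> i"] by (simp add: cover_instance_def)
  qed (use time S.w_nonneg S.f_diminishing in \<open>auto simp: total_rank_def[symmetric] S.f_mono image_mono\<close>,
       simp add: total_rank_def)
qed

text \<open>Indexing into \<open>es\<close> carries the program's run over positions to one greedy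
  run over elements.\<close>

lemma greedy_program_correct:
  assumes inst: "cover_instance (set es) k \<I> c" and dist: "distinct es"
    and time: "\<And>i A. i \<in> {1..k} \<Longrightarrow> A \<subseteq> {..<length es} \<Longrightarrow> \<tau> i A \<le> B"
    and T: "3 + (length es + 1) * (9 + k * (B + 4) + length es * (23 + k * (B + 10))) \<le> T"
  shows "\<exists>H. greedy_output (set es) k \<I> c H \<and> computes_within greedy_program es k \<I> c \<tau> T H"
proof -
  let ?F = "\<lambda>A. total_rank k \<I> ((!) es ` A)"
  interpret rank_machine "length es" ?F "\<lambda>j. c {es ! j}" "\<lambda>i A. mrank (\<I> i) ((!) es ` A)" \<tau> k B
    by (rule rank_machine_total_rank[OF inst time])
  obtain t s where s: "exec (\<lambda>j. c {es ! j}) (\<lambda>i A. mrank (\<I> i) ((!) es ` A)) \<tau> greedy_program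
        (initial (length es) k) t s" "t \<le> T" "arr s 0 \<subseteq> {..<length es}"
      "(\<lambda>A B. \<exists>e. best A e \<and> B = insert e A)\<^sup>*\<^sup>* {} (arr s 0)"
      "\<not> ?F (arr s 0) < ?F {..<length es}"
    using runs_greedy_program[OF T] unfolding runs_def by auto
  have sets: "(!) es ` {..<length es} = set es"
    by (auto simp: in_set_conv_nth)
  have "(greedy_step (set es) k \<I> c)\<^sup>*\<^sup>* {} ((!) es ` arr s 0) \<and> arr s 0 \<subseteq> {..<length es}"
    using s(4)
  proof induction
    case (step A A')
    then obtain e where e: "best A e" "A' = insert e A"
      by blast
    have A: "A \<subseteq> {..<length es}" and e': "e < length es"
      using step.IH e(1) by (auto simp: best_def)
    have "(!) es ` A \<subseteq> set es"
      using A sets by blast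
    moreover have "(!) es ` A' = insert (es ! e) ((!) es ` A)"
      using e(2) by simp
    ultimately have "greedy_step (set es) k \<I> c ((!) es ` A) ((!) es ` A')"
      using greedy_step_iff_best[OF inst] submodular_cover_axioms e(1) A
        best_reindex[OF inst dist refl] by blast
    thus ?case
      using step.IH e(2) e' by (auto intro: rtranclp.rtrancl_into_rtrancl)
  qed simp
  hence "greedy_output (set es) k \<I> c ((!) es ` arr s 0)"
    using s(5) by (simp add: greedy_output_def sets)
  thus ?thesis
    using s(1-3) unfolding computes_within_def by blast
qed

theorem theorem6:
  shows "(\<exists>C::real. \<forall>(E::'a set) k \<I> c H.
            cover_instance E k \<I> c \<longrightarrow> greedy_output E k \<I> c H \<longrightarrow>
              feasible E k \<I> H \<and>
              (2 \<le> k \<longrightarrow> (feasible E k \<I> {} \<longrightarrow> c {} = 0) \<longrightarrow> gamma_ratio E k \<I> c < \<infinity> \<longrightarrow>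
                approx_solution E k \<I> c
                  (C * (real_of_ereal (gamma_ratio E k \<I> c) * ln (real k))) H))
       \<and> (\<exists>P. \<forall>p::nat poly. \<exists>q::nat poly. \<forall>(es::'a list) k \<I> c \<tau>.
            distinct es \<longrightarrow> cover_instance (set es) k \<I> c \<longrightarrow>
            (\<forall>i\<in>{1..k}. \<forall>A. A \<subseteq> {..<length es} \<longrightarrow> \<tau> i A \<le> poly p (length es + k)) \<longrightarrow>
              (\<exists>H. greedy_output (set es) k \<I> c H \<and>
                   computes_within P es k \<I> c \<tau> (poly q (length es + k)) H))"
proof (intro conjI)
  show "\<exists>C::real. \<forall>(E::'a set) k \<I> c H.
            cover_instance E k \<I> c \<longrightarrow> greedy_output E k \<I> c H \<longrightarrow>
              feasible E k \<I> H \<and>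
              (2 \<le> k \<longrightarrow> (feasible E k \<I> {} \<longrightarrow> c {} = 0) \<longrightarrow> gamma_ratio E k \<I> c < \<infinity> \<longrightarrow>
                approx_solution E k \<I> c
                  (C * (real_of_ereal (gamma_ratio E k \<I> c) * ln (real k))) H)"
    using greedy_approximation by blast
next
  show "\<exists>P. \<forall>p::nat poly. \<exists>q::nat poly. \<forall>(es::'a list) k \<I> c \<tau>.
            distinct es \<longrightarrow> cover_instance (set es) k \<I> c \<longrightarrow>
            (\<forall>i\<in>{1..k}. \<forall>A. A \<subseteq> {..<length es} \<longrightarrow> \<tau> i A \<le> poly p (length es + k)) \<longrightarrow>
              (\<exists>H. greedy_output (set es) k \<I> c H \<and>
                   computes_within P es k \<I> c \<tau> (poly q (length es + k)) H)"
  proof (rule exI[of _ greedy_program], rule allI)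
    fix p :: "nat poly"
    define X where "X = ([:0, 1:] :: nat poly)"
    \<comment> \<open>The running time with both \<open>n\<close> and \<open>k\<close> replaced by
      \<open>n + k\<close>, the argument at which \<open>p\<close> is evaluated too.\<close>
    define q where "q = [:3:] + (X + [:1:]) * ([:9:] + X * (p + [:4:]) + X * ([:23:] + X * (p + [:10:])))"
    have q: "poly q N = 3 + (N + 1) * (9 + N * (poly p N + 4) + N * (23 + N * (poly p N + 10)))" for N
      by (simp add: q_def X_def algebra_simps)
    have "3 + (n + 1) * (9 + k * (poly p (n + k) + 4) + n * (23 + k * (poly p (n + k) + 10)))
        \<le> poly q (n + k)" for n k
      unfolding q by (intro add_mono mult_mono order_refl) simp_all
    thus "\<exists>q::nat poly. \<forall>(es::'a list) k \<I> c \<tau>.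
            distinct es \<longrightarrow> cover_instance (set es) k \<I> c \<longrightarrow>
            (\<forall>i\<in>{1..k}. \<forall>A. A \<subseteq> {..<length es} \<longrightarrow> \<tau> i A \<le> poly p (length es + k)) \<longrightarrow>
              (\<exists>H. greedy_output (set es) k \<I> c H \<and>
                   computes_within greedy_program es k \<I> c \<tau> (poly q (length es + k)) H)"
      by (intro exI[of _ q] allI impI greedy_program_correct) auto
  qed
qed

end
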